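(* Consider the problem $\min_{x\in\mathbb{R}^n}F(x)$ with $F=(F_1,\dots,F_m)$, $F_i=f_i+g_i$, where each $f_i$ is continuously differentiable and each $g_i$ is proper, convex and lower semicontinuous. Assume that $\Omega=\{x\in\mathbb{R}^n:F(x)\preceq F(x^0)\}$ is a bounded set and that $f_i$ is convex and $L_i$-smooth for every $i\in[m]$. Let $\{x^k\}$ be the (infinite) sequence generated from $x^0$ by the Barzilai-Borwein proximal gradient method with line search (BBPGMO, described in the context). Then: (i) $\{x^k\}$ converges to some weakly Pareto solution $x^*$. (ii) There exists a constant $c>0$ such that for all $k\ge1$, $u_0^{\alpha_{\min}}(x^k)\le\frac{c}{k}$, where $u_0^{\alpha_{\min}}(x)=\sup_{y\in\mathbb{R}^n}\min_{i\in[m]}\frac{F_i(x)-F_i(y)}{\alpha_{\min}}$.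
   Context: Notation: $[m]=\{1,\dots,m\}$; for $u,v\in\mathbb{R}^m$, $u\preceq v$ means $u_i\le v_i$ for all $i$, and $u\prec v$ means $u_i<v_i$ for all $i$. $F:\mathbb{R}^n\to\mathbb{R}^m$. A point $x^*$ is a weakly Pareto solution if there is no $x$ with $F(x)\prec F(x^* )$. It is Pareto critical if $\max_{i\in[m]}F_i'(x^*;d)\ge0$ for all $d\in\mathbb{R}^n$, where $F_i'(x;d)$ is the directional derivative. A differentiable $h$ is $L$-smooth if $\|\nabla h(y)-\nabla h(x)\|\le L\|y-x\|$ for all $x,y$. BBPGMO with line search. Fix $\sigma,\gamma\in(0,1)$ and constants $0<\alpha_{\min}<\alpha_{\max}$ ($\alpha_{\min}$ sufficiently small, $\alpha_{\max}$ sufficiently large). Given $x^0$, choose $x^{-1}\ne x^0$ in a small neighborhood of $x^0$. For $k=0,1,2,\dots$: 1. With $s^{k-1}=x^k-x^{k-1}$ and $y_i^{k-1}=\nabla f_i(x^k)-\nabla f_i(x^{k-1})$, set for each $i\in[m]$: $\alpha_i^k=\max\{\alpha_{\min},\min\{\langle s^{k-1},y_i^{k-1}\rangle/\langle s^{k-1},s^{k-1}\rangle,\alpha_{\max}\}\}$ if $\langle s^{k-1},y_i^{k-1}\rangle>0$; $\alpha_i^k=\max\{\alpha_{\min},\min\{\|y_i^{k-1}\|/\|s^{k-1}\|,\alpha_{\max}\}\}$ if $\langle s^{k-1},y_i^{k-1}\rangle<0$; $\alpha_i^k=\alpha_{\min}$ if $\langle s^{k-1},y_i^{k-1}\rangle=0$.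 2. Let $P_{\alpha^k}(x^k)$ be the unique minimizer over $x\in\mathbb{R}^n$ of $\max_{i\in[m]}\left\{\frac{\langle\nabla f_i(x^k),x-x^k\rangle+g_i(x)-g_i(x^k)}{\alpha_i^k}+\frac12\|x-x^k\|^2\right\}$ and set $d^k=P_{\alpha^k}(x^k)-x^k$. Stop if $d^k=0$. 3. Let $t_k$ be the largest element of $\{\gamma^j:j=0,1,2,\dots\}$ such that $F_i(x^k+t_kd^k)-F_i(x^k)\le t_k\sigma\left(\langle\nabla f_i(x^k),d^k\rangle+g_i(x^k+d^k)-g_i(x^k)\right)$ for all $i\in[m]$ (Armijo backtracking starting at $1$), and set $x^{k+1}=x^k+t_kd^k$. Standing assumption: the algorithm does not stop, i.e. it produces an infinite sequence of points that are not Pareto critical. *)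

theory Defs
  imports "HOL-Analysis.Analysis"
begin

text \<open>
  The objectives are indexed by a finite type \<open>'m\<close>, so that \<open>F\<close> is a family
  \<open>F :: 'm \<Rightarrow> real ^ 'n \<Rightarrow> ereal\<close>. The nonsmooth parts may take the value \<open>\<infinity>\<close>.
\<close>

definition proper :: "('a \<Rightarrow> ereal) \<Rightarrow> bool" where
  "proper g \<longleftrightarrow> (\<forall>x. g x \<noteq> -\<infinity>) \<and> (\<exists>x. g x \<noteq> \<infinity>)"

text \<open>Only meaningful for functions that avoid \<open>-\<infinity>\<close>; recall that \<open>0 * \<infinity> = 0\<close> in \<^typ>\<open>ereal\<close>.\<close>

definition convex_ereal :: "('a::real_vector \<Rightarrow> ereal) \<Rightarrow> bool" where
  "convex_ereal g \<longleftrightarrow> (\<forall>x y. \<forall>u\<in>{0..1::real}.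
     g ((1 - u) *\<^sub>R x + u *\<^sub>R y) \<le> ereal (1 - u) * g x + ereal u * g y)"

definition lsc :: "('a::topological_space \<Rightarrow> ereal) \<Rightarrow> bool" where
  "lsc g \<longleftrightarrow> (\<forall>x. g x \<le> Liminf (at x) g)"

definition composite :: "('m \<Rightarrow> 'a \<Rightarrow> real) \<Rightarrow> ('m \<Rightarrow> 'a \<Rightarrow> ereal) \<Rightarrow> 'm \<Rightarrow> 'a \<Rightarrow> ereal" where
  "composite f g i x = ereal (f i x) + g i x"

definition in_dom :: "('m \<Rightarrow> 'a \<Rightarrow> ereal) \<Rightarrow> 'a \<Rightarrow> bool" where
  "in_dom F x \<longleftrightarrow> (\<forall>i. \<bar>F i x\<bar> \<noteq> \<infinity>)"

text \<open>A solution is required to be feasible, i.e. all its objective values are finite.\<close>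

definition weakly_pareto :: "('m \<Rightarrow> 'a \<Rightarrow> ereal) \<Rightarrow> 'a \<Rightarrow> bool" where
  "weakly_pareto F xs \<longleftrightarrow> in_dom F xs \<and> \<not> (\<exists>x. \<forall>i. F i x < F i xs)"

definition dir_deriv :: "('a::real_vector \<Rightarrow> ereal) \<Rightarrow> 'a \<Rightarrow> 'a \<Rightarrow> ereal" where
  "dir_deriv \<phi> x d = Lim (at_right (0::real)) (\<lambda>t. (\<phi> (x + t *\<^sub>R d) - \<phi> x) / ereal t)"

definition pareto_critical :: "('m::finite \<Rightarrow> 'a::real_vector \<Rightarrow> ereal) \<Rightarrow> 'a \<Rightarrow> bool" where
  "pareto_critical F x \<longleftrightarrow> (\<forall>d. (MAX i. dir_deriv (F i) x d) \<ge> 0)"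

definition L_smooth :: "real \<Rightarrow> ('a::real_normed_vector \<Rightarrow> 'a) \<Rightarrow> bool" where
  "L_smooth L grad \<longleftrightarrow> (\<forall>x y. norm (grad y - grad x) \<le> L * norm (y - x))"

definition merit_u0 :: "real \<Rightarrow> ('m::finite \<Rightarrow> 'a \<Rightarrow> ereal) \<Rightarrow> 'a \<Rightarrow> ereal" where
  "merit_u0 a F x = (SUP y. MIN i. (F i x - F i y) / ereal a)"

definition bb_param :: "real \<Rightarrow> real \<Rightarrow> 'a::real_inner \<Rightarrow> 'a \<Rightarrow> real" where
  "bb_param amin amax s y =
     (if s \<bullet> y > 0 then max amin (min ((s \<bullet> y) / (s \<bullet> s)) amax)
      else if s \<bullet> y < 0 then max amin (min (norm y / norm s) amax)
      else amin)"

text \<open>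
  \<open>lin_model G g x z i\<close> is $\langle\nabla f_i(x), z - x\rangle + g_i(z) - g_i(x)$, where
  \<open>G i\<close> is the gradient of \<open>f i\<close>.
\<close>

definition lin_model ::
  "('m \<Rightarrow> 'a::real_inner \<Rightarrow> 'a) \<Rightarrow> ('m \<Rightarrow> 'a \<Rightarrow> ereal) \<Rightarrow> 'a \<Rightarrow> 'a \<Rightarrow> 'm \<Rightarrow> ereal" where
  "lin_model G g x z i = ereal (G i x \<bullet> (z - x)) + g i z - g i x"

definition prox_model ::
  "('m::finite \<Rightarrow> 'a::real_inner \<Rightarrow> 'a) \<Rightarrow> ('m \<Rightarrow> 'a \<Rightarrow> ereal) \<Rightarrow> ('m \<Rightarrow> real) \<Rightarrow> 'a \<Rightarrow> 'a \<Rightarrow> ereal" where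
  "prox_model G g \<alpha> x z =
     (MAX i. lin_model G g x z i / ereal (\<alpha> i) + ereal ((1/2) * (norm (z - x))\<^sup>2))"

definition armijo ::
  "real \<Rightarrow> ('m \<Rightarrow> 'a::real_inner \<Rightarrow> real) \<Rightarrow> ('m \<Rightarrow> 'a \<Rightarrow> 'a) \<Rightarrow> ('m \<Rightarrow> 'a \<Rightarrow> ereal) \<Rightarrow> 'a \<Rightarrow> 'a \<Rightarrow> real \<Rightarrow> bool" where
  "armijo \<sigma> f G g x d t \<longleftrightarrow>
     (\<forall>i. composite f g i (x + t *\<^sub>R d) - composite f g i x
            \<le> ereal (t * \<sigma>) * lin_model G g x (x + d) i)"

text \<open>
  \<open>bbpgmo_run \<dots> xm1 x\<close> states that \<open>x\<close> is an infinite sequence of iterates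
  \<open>x 0, x 1, \<dots>\<close>; \<open>xm1\<close> is the auxiliary point $x^{-1}$, only used for the first
  parameters. The point \<open>x k + d k\<close> is the minimizer $P_{\alpha^k}(x^k)$, unique because
  the model is strongly convex, and \<open>d k \<noteq> 0\<close> says that the method does not stop.
\<close>

definition bbpgmo_run ::
  "real \<Rightarrow> real \<Rightarrow> real \<Rightarrow> real \<Rightarrow>
   ('m::finite \<Rightarrow> 'a::real_inner \<Rightarrow> real) \<Rightarrow> ('m \<Rightarrow> 'a \<Rightarrow> 'a) \<Rightarrow> ('m \<Rightarrow> 'a \<Rightarrow> ereal) \<Rightarrow>
   'a \<Rightarrow> (nat \<Rightarrow> 'a) \<Rightarrow> bool" where
  "bbpgmo_run \<sigma> \<gamma> amin amax f G g xm1 x \<longleftrightarrow>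
     xm1 \<noteq> x 0 \<and>
     (\<exists>(\<alpha> :: nat \<Rightarrow> 'm \<Rightarrow> real) (d :: nat \<Rightarrow> 'a) (t :: nat \<Rightarrow> real). \<forall>k.
        (let xprev = (case k of 0 \<Rightarrow> xm1 | Suc j \<Rightarrow> x j) in
           \<forall>i. \<alpha> k i = bb_param amin amax (x k - xprev) (G i (x k) - G i xprev)) \<and>
        is_arg_min (prox_model G g (\<alpha> k) (x k)) (\<lambda>_. True) (x k + d k) \<and>
        d k \<noteq> 0 \<and>
        is_arg_max id (\<lambda>s. s \<in> range (\<lambda>j::nat. \<gamma> ^ j) \<and> armijo \<sigma> f G g (x k) (d k) s) (t k) \<and>
        x (Suc k) = x k + t k *\<^sub>R d k)"

end

theory Submission
  imports Defs
begin

text \<open>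
  The prox model at \<open>x\<^sub>k\<close> is strongly convex, so for every \<open>z\<close> with
  \<open>F\<^sub>i z + r \<le> F\<^sub>i x\<^sub>k\<close> for all \<open>i\<close>, where \<open>r \<ge> 0\<close>, comparing its values at \<open>z\<close> and at the
  minimizer \<open>x\<^sub>k + d\<^sub>k\<close>, and bounding the model decrease by the Armijo decrease, gives
  \<open>t\<^sub>k r / \<alpha>\<^sub>m\<^sub>a\<^sub>x \<le> |z - x\<^sub>k|\<^sup>2/2 - |z - x\<^sub>k\<^sub>+\<^sub>1|\<^sup>2/2 + (F\<^sub>i x\<^sub>k - F\<^sub>i x\<^sub>k\<^sub>+\<^sub>1) / (\<sigma> \<alpha>\<^sub>m\<^sub>i\<^sub>n)\<close>
  for each \<open>i\<close>; no multipliers or subgradients are needed. Since \<open>f\<^sub>i\<close> is smooth, \<open>t\<^sub>k\<close> is bounded below.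
  A cluster point \<open>z\<close> of the bounded sequence satisfies \<open>F z \<le> F x\<^sub>k\<close> for all \<open>k\<close> by lower
  semicontinuity; the case \<open>r = 0\<close> says that \<open>|z - x\<^sub>k|\<^sup>2/2 + F\<^sub>i x\<^sub>k / (\<sigma> \<alpha>\<^sub>m\<^sub>i\<^sub>n)\<close> decreases, which
  forces convergence to \<open>z\<close>. For general \<open>r\<close> the inequality telescopes to \<open>k r \<le> const\<close>,
  which is the rate, and also excludes a \<open>z\<close> that strictly dominates the limit.
\<close>

section \<open>Gradient inequality and strong convexity of the proximal term\<close>

text \<open>Along the line through \<open>x\<close> and \<open>y\<close> the function is convex in
  one real variable with slope \<open>D \<bullet> (y - x)\<close> at 0, and the tangent at 0 bounds
  its value at 1 from below.\<close>

lemma convex_on_gradient_ineq: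
  fixes f :: "'a::euclidean_space \<Rightarrow> real"
  assumes "convex_on UNIV f" "GDERIV f x :> D"
  shows "D \<bullet> (y - x) \<le> f y - f x"
proof -
  define \<phi> where "\<phi> = (\<lambda>s::real. f (x + s *\<^sub>R (y - x)))"
  have "convex_on UNIV \<phi>"
  proof (rule convex_onI)
    fix u a b :: real
    assume "0 < u" "u < 1"
    moreover have "x + ((1 - u) *\<^sub>R a + u *\<^sub>R b) *\<^sub>R (y - x) =
        (1 - u) *\<^sub>R (x + a *\<^sub>R (y - x)) + u *\<^sub>R (x + b *\<^sub>R (y - x))"
      by (simp add: algebra_simps)
    ultimately show "\<phi> ((1 - u) *\<^sub>R a + u *\<^sub>R b) \<le> (1 - u) * \<phi> a + u * \<phi> b"
      unfolding \<phi>_def using convex_onD[OF assms(1), of u] by simp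
  qed simp
  moreover have "(\<phi> has_field_derivative D \<bullet> (y - x)) (at 0)"
  proof -
    have f: "(f has_derivative (\<lambda>h. h \<bullet> D)) (at (x + 0 *\<^sub>R (y - x)))"
      using assms(2) by (simp add: gderiv_def)
    have "((\<lambda>s::real. x + s *\<^sub>R (y - x)) has_derivative (\<lambda>h. h *\<^sub>R (y - x))) (at 0)"
      by (auto intro!: derivative_eq_intros)
    from has_derivative_compose[OF this f] show ?thesis
      by (simp add: \<phi>_def has_field_derivative_def inner_commute mult_commute_abs)
  qed
  ultimately show ?thesis
    using convex_on_imp_above_tangent[of UNIV \<phi> 0 1 "D \<bullet> (y - x)"] by (simp add: \<phi>_def)
qed

text \<open>The defect with factor \<open>u * (1 - u)\<close> is the strong convexity of the squared
  norm; it is the source of the term in \<open>z - p\<close> in the three-point inequality.\<close>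

lemma norm_convex_comb_sq:
  fixes a b :: "'a::real_inner"
  shows "(norm ((1 - u) *\<^sub>R a + u *\<^sub>R b))\<^sup>2 =
         (1 - u) * (norm a)\<^sup>2 + u * (norm b)\<^sup>2 - u * (1 - u) * (norm (a - b))\<^sup>2"
  unfolding power2_norm_eq_inner
  by (simp add: inner_simps inner_commute) (simp add: algebra_simps)

text \<open>The bounds \<open>b\<close> and \<open>a\<close> stand in for the maxima of the
  \<open>\<psi> i\<close> at \<open>p\<close> and \<open>z\<close>, and \<open>opt\<close> phrases
  minimality of \<open>p\<close> through upper bounds, which keeps maxima out of the argument.
  Strong convexity of the quadratic supplies the extra
  \<open>(norm (z - p))\<^sup>2 / 2\<close>.\<close>

lemma prox_three_point:
  fixes \<psi> :: "'i \<Rightarrow> 'a::real_inner \<Rightarrow> real"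
  assumes conv: "\<And>i. convex_on D (\<psi> i)" and "convex D" "p \<in> D" "z \<in> D"
    and b: "\<And>i. \<psi> i p \<le> b" and a: "\<And>i. \<psi> i z \<le> a"
    and opt: "\<And>y c. y \<in> D \<Longrightarrow> (\<And>i. \<psi> i y \<le> c) \<Longrightarrow>
      b + (norm (p - x))\<^sup>2 / 2 \<le> c + (norm (y - x))\<^sup>2 / 2"
  shows "b + (norm (p - x))\<^sup>2 / 2 + (norm (z - p))\<^sup>2 / 2 \<le> a + (norm (z - x))\<^sup>2 / 2"
proof -
  define N where "N = (norm (z - p))\<^sup>2 / 2"
  define c where "c = b + (norm (p - x))\<^sup>2 / 2 - a - (norm (z - x))\<^sup>2 / 2 + N"
  \<comment> \<open>Compare \<open>p\<close> with the points of the segment from \<open>p\<close> to \<open>z\<close>, then let \<open>u \<rightarrow> 0\<close>.\<close>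
  have le: "c \<le> u * N" if u: "0 < u" "u < 1" for u
  proof -
    let ?y = "(1 - u) *\<^sub>R p + u *\<^sub>R z"
    have "?y \<in> D"
      using \<open>convex D\<close> assms(3,4) u by (intro convexD) auto
    moreover have "\<psi> i ?y \<le> (1 - u) * b + u * a" for i
    proof -
      have "\<psi> i ?y \<le> (1 - u) * \<psi> i p + u * \<psi> i z"
        using convex_onD[OF conv[of i]] assms(3,4) u by simp
      also have "\<dots> \<le> (1 - u) * b + u * a"
        using a b u by (intro add_mono mult_left_mono) auto
      finally show ?thesis .
    qed
    ultimately have "b + (norm (p - x))\<^sup>2 / 2 \<le> (1 - u) * b + u * a + (norm (?y - x))\<^sup>2 / 2"
      by (rule opt)
    moreover have "?y - x = (1 - u) *\<^sub>R (p - x) + u *\<^sub>R (z - x)"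
      by (simp add: algebra_simps)
    then have "(norm (?y - x))\<^sup>2 = (1 - u) * (norm (p - x))\<^sup>2 + u * (norm (z - x))\<^sup>2
        - u * (1 - u) * (norm (z - p))\<^sup>2"
      by (simp only: norm_convex_comb_sq) (simp add: norm_minus_commute)
    ultimately have "u * c \<le> u * (u * N)"
      by (simp add: c_def N_def field_simps)
    then show ?thesis
      using u by simp
  qed
  have "eventually (\<lambda>u. u \<in> {0<..<1}) (at_right (0::real))"
    by (rule eventually_at_right_real) simp
  then have "eventually (\<lambda>u. c \<le> u * N) (at_right 0)"
    by (rule eventually_mono) (use le in auto)
  moreover have "((\<lambda>u. u * N) \<longlongrightarrow> 0 * N) (at_right 0)"
    by (intro tendsto_intros)
  ultimately have "c \<le> 0 * N"
    by (intro tendsto_lowerbound) auto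
  then show ?thesis
    by (simp add: c_def N_def)
qed

section \<open>Sequential lower semicontinuity and bounds on the step parameters\<close>

text \<open>If the bound failed at \<open>l\<close>, then \<open>\<phi>\<close> would exceed
  \<open>c\<close> on a neighbourhood that \<open>y\<close> eventually enters. The filter
  \<open>at l\<close> leaves out \<open>l\<close> itself, where the negated claim takes
  over.\<close>

lemma lsc_sequentially_le:
  assumes "lsc \<phi>" "y \<longlonglongrightarrow> l" "eventually (\<lambda>n. \<phi> (y n) \<le> c) sequentially"
  shows "\<phi> l \<le> c"
proof (rule ccontr)
  assume "\<not> \<phi> l \<le> c"
  with \<open>lsc \<phi>\<close> have "c < Liminf (at l) \<phi>"
    by (auto simp: lsc_def not_le intro: less_le_trans)
  then have "eventually (\<lambda>z. c < \<phi> z) (at l)"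
    by (rule less_LiminfD)
  with \<open>\<not> \<phi> l \<le> c\<close> have "eventually (\<lambda>z. c < \<phi> z) (nhds l)"
    by (auto simp: eventually_at_filter elim!: eventually_mono)
  then have "eventually (\<lambda>n. c < \<phi> (y n)) sequentially"
    using assms(2) by (rule eventually_compose_filterlim)
  with assms(3) have "eventually (\<lambda>n. False) sequentially"
    by eventually_elim auto
  then show False
    by simp
qed

lemma bb_param_bounds:
  assumes "amin \<le> amax"
  shows "amin \<le> bb_param amin amax s y" "bb_param amin amax s y \<le> amax"
  using assms by (auto simp: bb_param_def)

section \<open>The composite objective, its domain and short Armijo steps\<close>

locale composite_problem =
  fixes f :: "'m::finite \<Rightarrow> 'a::euclidean_space \<Rightarrow> real"
    and G :: "'m \<Rightarrow> 'a \<Rightarrow> 'a"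
    and g :: "'m \<Rightarrow> 'a \<Rightarrow> ereal"
    and L :: "'m \<Rightarrow> real"
  assumes grad: "\<And>i z. GDERIV (f i) z :> G i z"
    and g_proper: "\<And>i. proper (g i)"
    and g_convex: "\<And>i. convex_ereal (g i)"
    and g_lsc: "\<And>i. lsc (g i)"
    and f_convex: "\<And>i. convex_on UNIV (f i)"
    and f_smooth: "\<And>i. L_smooth (L i) (G i)"
begin

text \<open>The effective domain common to all \<open>g i\<close>. Properness rules out
  \<open>-\<infinity>\<close>, so all values are finite here.\<close>

definition D :: "'a set" where
  "D = {z. \<forall>i. g i z \<noteq> \<infinity>}"

text \<open>Only meaningful on \<open>D\<close>: outside, \<^const>\<open>real_of_ereal\<close> returns \<open>0\<close>.\<close>

definition h :: "'m \<Rightarrow> 'a \<Rightarrow> real" where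
  "h i z = real_of_ereal (g i z)"

lemma g_not_MInf: "g i z \<noteq> -\<infinity>"
  using g_proper by (auto simp: proper_def)

lemma g_eq: "z \<in> D \<Longrightarrow> g i z = ereal (h i z)"
  using g_not_MInf[of i z] by (auto simp: D_def h_def ereal_real)

lemma composite_eq: "z \<in> D \<Longrightarrow> composite f g i z = ereal (f i z + h i z)"
  by (simp add: composite_def g_eq)

lemma composite_not_MInf: "composite f g i z \<noteq> -\<infinity>"
  using g_not_MInf[of i z] by (cases "g i z") (auto simp: composite_def)

lemma D_iff: "z \<in> D \<longleftrightarrow> (\<forall>i. composite f g i z < \<infinity>)"
  by (auto simp: D_def composite_def less_top[symmetric])

lemma in_dom_iff: "in_dom (composite f g) z \<longleftrightarrow> z \<in> D"
proof -
  have "\<bar>composite f g i z\<bar> \<noteq> \<infinity> \<longleftrightarrow> composite f g i z < \<infinity>" for i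
    using composite_not_MInf[of i z] by (cases "composite f g i z") auto
  then show ?thesis
    by (simp add: in_dom_def D_iff)
qed

lemma convex_comb_dom:
  assumes "y \<in> D" "z \<in> D" "0 \<le> u" "u \<le> 1"
  shows "(1 - u) *\<^sub>R y + u *\<^sub>R z \<in> D"
    and "h i ((1 - u) *\<^sub>R y + u *\<^sub>R z) \<le> (1 - u) * h i y + u * h i z"
proof -
  have *: "g i ((1 - u) *\<^sub>R y + u *\<^sub>R z) \<le> ereal ((1 - u) * h i y + u * h i z)" for i
    using g_convex[of i, unfolded convex_ereal_def, rule_format, of u y z] assms by (simp add: g_eq)
  show "(1 - u) *\<^sub>R y + u *\<^sub>R z \<in> D"
    unfolding D_def using le_less_trans[OF *, where z = \<infinity>] by (auto simp: less_top[symmetric])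
  with *[of i] show "h i ((1 - u) *\<^sub>R y + u *\<^sub>R z) \<le> (1 - u) * h i y + u * h i z"
    by (simp add: g_eq)
qed

lemma convex_D: "convex D"
  unfolding convex_alt by (blast intro: convex_comb_dom(1))

text \<open>Continuity of \<open>f i\<close> moves the bound to \<open>g i\<close> at the cost of an
  arbitrary \<open>e > 0\<close>, and lower semicontinuity of \<open>g i\<close> carries it to the
  limit. This places cluster points of the iterates in sublevel sets.\<close>

lemma composite_lsc_le:
  assumes "y \<longlonglongrightarrow> l" "eventually (\<lambda>n. composite f g i (y n) \<le> ereal c) sequentially"
  shows "composite f g i l \<le> ereal c"
proof -
  have "isCont (f i) l"
    by (rule has_derivative_continuous[OF grad[unfolded gderiv_def]])
  then have lim: "(\<lambda>n. f i (y n)) \<longlonglongrightarrow> f i l"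
    using assms(1) by (rule isCont_tendsto_compose)
  have "g i l \<le> ereal (c - f i l) + ereal e" if "e > 0" for e
  proof -
    have "eventually (\<lambda>n. f i l - e < f i (y n)) sequentially"
      by (rule order_tendstoD(1)[OF lim]) (use that in simp)
    with assms(2) have "eventually (\<lambda>n. g i (y n) \<le> ereal (c - f i l + e)) sequentially"
    proof eventually_elim
      case (elim n)
      then show ?case
        by (cases "g i (y n)") (auto simp: composite_def)
    qed
    from lsc_sequentially_le[OF g_lsc assms(1) this] show ?thesis
      by simp
  qed
  then have "g i l \<le> ereal (c - f i l)"
    by (blast intro: ereal_le_epsilon2)
  then show ?thesis
    by (cases "g i l") (auto simp: composite_def)
qed

text \<open>The gradient inequality at the new point gives the descent lemma with \<open>L\<close> in place of \<open>L/2\<close>;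
  the constant is immaterial here.\<close>

lemma armijo_small_step:
  assumes "y \<in> D" "y + d \<in> D" "0 < t" "t \<le> 1" "\<sigma> < 1"
    and t: "\<And>i. t * L i \<le> (1 - \<sigma>) * a"
    and desc: "\<And>i. G i y \<bullet> d + h i (y + d) - h i y \<le> - a * (norm d)\<^sup>2"
  shows "armijo \<sigma> f G g y d t"
  unfolding armijo_def
proof
  fix i
  let ?z = "y + t *\<^sub>R d" and ?l = "G i y \<bullet> d + h i (y + d) - h i y"
  have z: "?z = (1 - t) *\<^sub>R y + t *\<^sub>R (y + d)"
    by (simp add: algebra_simps)
  have "?z \<in> D" and h: "h i ?z \<le> (1 - t) * h i y + t * h i (y + d)"
    unfolding z using assms by (auto intro!: convex_comb_dom)
  have "G i ?z \<bullet> (y - ?z) \<le> f i y - f i ?z"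
    by (intro convex_on_gradient_ineq f_convex grad)
  then have f: "f i ?z - f i y \<le> t * (G i y \<bullet> d) + t * ((G i ?z - G i y) \<bullet> d)"
    by (simp add: inner_simps algebra_simps)
  have "(G i ?z - G i y) \<bullet> d \<le> norm (G i ?z - G i y) * norm d"
    by (rule norm_cauchy_schwarz)
  also have "\<dots> \<le> (L i * norm (?z - y)) * norm d"
    using f_smooth[of i] by (intro mult_right_mono) (simp_all only: L_smooth_def norm_ge_zero)
  also have "\<dots> = (t * L i) * (norm d)\<^sup>2"
    using assms by (simp add: power2_eq_square)
  also have "\<dots> \<le> ((1 - \<sigma>) * a) * (norm d)\<^sup>2"
    by (intro mult_right_mono t) auto
  also have "\<dots> = (1 - \<sigma>) * (a * (norm d)\<^sup>2)"
    by simp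
  also have "\<dots> \<le> (1 - \<sigma>) * (- ?l)"
    using desc[of i] \<open>\<sigma> < 1\<close> by (intro mult_left_mono) linarith+
  finally have "t * ((G i ?z - G i y) \<bullet> d) \<le> t * ((1 - \<sigma>) * (- ?l))"
    using assms by (intro mult_left_mono) auto
  \<comment> \<open>The gradient error consumes the share \<open>1 - \<sigma>\<close> of the
    predicted decrease \<open>t * ?l\<close> and leaves \<open>t * \<sigma> * ?l\<close>.\<close>
  with f h have "f i ?z + h i ?z - (f i y + h i y) \<le> t * \<sigma> * ?l"
    by (simp add: algebra_simps)
  with \<open>?z \<in> D\<close> assms(1,2) show "composite f g i ?z - composite f g i y \<le> ereal (t * \<sigma>) * lin_model G g y (y + d) i"
    by (simp add: composite_eq lin_model_def g_eq)
qed

section \<open>One proximal step with line search\<close>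

text \<open>A real-valued copy of the objective, so that differences can be telescoped without
  infinities. It is meaningful on \<open>D\<close> only.\<close>

definition \<Phi> :: "'m \<Rightarrow> 'a \<Rightarrow> real" where
  "\<Phi> i z = f i z + h i z"

lemma composite_eq_Phi: "z \<in> D \<Longrightarrow> composite f g i z = ereal (\<Phi> i z)"
  by (simp add: composite_eq \<Phi>_def)

lemma prox_model_eq:
  assumes "y \<in> D" "z \<in> D" "\<And>i. 0 < \<alpha> i"
  shows "prox_model G g \<alpha> y z =
    (MAX i. ereal ((G i y \<bullet> (z - y) + h i z - h i y) / \<alpha> i + (norm (z - y))\<^sup>2 / 2))"
  using assms by (simp add: prox_model_def lin_model_def g_eq less_imp_neq[symmetric])

text \<open>Turns optimality in the extended-valued model into a real inequality. The number
  \<open>b\<close> is the largest scaled linear term at \<open>p\<close>, and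
  \<open>prox_three_point\<close> adds the distance from \<open>z\<close> to
  \<open>p\<close>.\<close>

lemma prox_minimizer:
  assumes "y \<in> D" and \<alpha>: "\<And>i. 0 < \<alpha> i"
    and min: "is_arg_min (prox_model G g \<alpha> y) (\<lambda>_. True) p"
  obtains b where "p \<in> D" "\<And>i. (G i y \<bullet> (p - y) + h i p - h i y) / \<alpha> i \<le> b"
    "\<And>z a. z \<in> D \<Longrightarrow> (\<And>i. (G i y \<bullet> (z - y) + h i z - h i y) / \<alpha> i \<le> a) \<Longrightarrow>
      b + (norm (p - y))\<^sup>2 / 2 + (norm (z - p))\<^sup>2 / 2 \<le> a + (norm (z - y))\<^sup>2 / 2"
proof -
  define \<psi> where "\<psi> = (\<lambda>i z. (G i y \<bullet> (z - y) + h i z - h i y) / \<alpha> i)"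
  have model: "prox_model G g \<alpha> y z = (MAX i. ereal (\<psi> i z + (norm (z - y))\<^sup>2 / 2))"
    if "z \<in> D" for z
    using prox_model_eq[OF \<open>y \<in> D\<close> that \<alpha>] by (simp add: \<psi>_def)
  have minD: "prox_model G g \<alpha> y p \<le> prox_model G g \<alpha> y z" for z
    using min by (simp add: is_arg_min_def not_less)
  \<comment> \<open>Outside \<open>D\<close> the model is infinite, whereas its value at
    \<open>y\<close> is finite.\<close>
  have "p \<in> D"
    unfolding D_def
  proof (intro CollectI allI notI)
    fix i
    assume "g i p = \<infinity>"
    have "lin_model G g y p i / ereal (\<alpha> i) + ereal (1 / 2 * (norm (p - y))\<^sup>2)
        \<le> prox_model G g \<alpha> y p"
      unfolding prox_model_def by (intro Max_ge) auto
    also have "\<dots> \<le> prox_model G g \<alpha> y y"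
      by (rule minD)
    also have "\<dots> < \<infinity>"
      unfolding model[OF \<open>y \<in> D\<close>] by (subst Max_less_iff) auto
    finally show False
      using \<open>g i p = \<infinity>\<close> \<open>y \<in> D\<close> \<alpha>[of i] by (simp add: lin_model_def g_eq)
  qed
  have "(MAX i. ereal (\<psi> i p + (norm (p - y))\<^sup>2 / 2)) \<in>
      range (\<lambda>i. ereal (\<psi> i p + (norm (p - y))\<^sup>2 / 2))"
    by (intro Max_in) auto
  then obtain i0 where i0:
    "prox_model G g \<alpha> y p = ereal (\<psi> i0 p + (norm (p - y))\<^sup>2 / 2)"
    unfolding model[OF \<open>p \<in> D\<close>] by blast
  have b: "\<psi> i p \<le> \<psi> i0 p" for i
  proof -
    have "ereal (\<psi> i p + (norm (p - y))\<^sup>2 / 2) \<le> prox_model G g \<alpha> y p"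
      unfolding model[OF \<open>p \<in> D\<close>] by (intro Max_ge) auto
    then show ?thesis
      by (simp add: i0)
  qed
  have opt: "\<psi> i0 p + (norm (p - y))\<^sup>2 / 2 \<le> c + (norm (z - y))\<^sup>2 / 2"
    if "z \<in> D" "\<And>i. \<psi> i z \<le> c" for z c
  proof -
    have "prox_model G g \<alpha> y z \<le> ereal (c + (norm (z - y))\<^sup>2 / 2)"
      unfolding model[OF \<open>z \<in> D\<close>] using that(2) by (subst Max_le_iff) auto
    with minD[of z] have "ereal (\<psi> i0 p + (norm (p - y))\<^sup>2 / 2) \<le> ereal (c + (norm (z - y))\<^sup>2 / 2)"
      unfolding i0 by (rule order_trans)
    then show ?thesis
      by simp
  qed
  have conv: "convex_on D (\<psi> i)" for i
  proof (rule convex_onI)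
    fix u :: real and v w
    assume u: "0 < u" "u < 1" and "v \<in> D" "w \<in> D"
    let ?z = "(1 - u) *\<^sub>R v + u *\<^sub>R w"
    have "G i y \<bullet> (?z - y) + h i ?z - h i y \<le>
        (1 - u) * (G i y \<bullet> (v - y) + h i v - h i y) + u * (G i y \<bullet> (w - y) + h i w - h i y)"
      using convex_comb_dom(2)[OF \<open>v \<in> D\<close> \<open>w \<in> D\<close>, of u i] u
      by (simp add: inner_simps algebra_simps)
    then have "\<psi> i ?z \<le> ((1 - u) * (G i y \<bullet> (v - y) + h i v - h i y) +
        u * (G i y \<bullet> (w - y) + h i w - h i y)) / \<alpha> i"
      unfolding \<psi>_def using less_imp_le[OF \<alpha>] by (rule divide_right_mono)
    then show "\<psi> i ?z \<le> (1 - u) * \<psi> i v + u * \<psi> i w"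
      by (simp add: \<psi>_def add_divide_distrib)
  qed (rule convex_D)
  show thesis
  proof (rule that[OF \<open>p \<in> D\<close>])
    show "(G i y \<bullet> (p - y) + h i p - h i y) / \<alpha> i \<le> \<psi> i0 p" for i
      using b[of i] by (simp add: \<psi>_def)
    show "\<psi> i0 p + (norm (p - y))\<^sup>2 / 2 + (norm (z - p))\<^sup>2 / 2 \<le> a + (norm (z - y))\<^sup>2 / 2"
      if "z \<in> D" "\<And>i. (G i y \<bullet> (z - y) + h i z - h i y) / \<alpha> i \<le> a" for z a
      using conv convex_D \<open>p \<in> D\<close> \<open>z \<in> D\<close> b _ opt
      by (rule prox_three_point) (simp add: \<psi>_def that)
  qed
qed

text \<open>In the last claim \<open>r\<close> is a gap by which \<open>z\<close> improves on
  \<open>y\<close> in every objective. The claim adds three estimates: the model comparison of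
  \<open>z\<close> with the minimizer, scaled by \<open>t\<close>; convexity of the squared norm, to
  pass from \<open>y + d\<close> to the point actually reached; and the Armijo condition, to bound
  \<open>- b\<close>.\<close>

lemma bbpgmo_step:
  assumes "y \<in> D" and \<alpha>: "\<And>i. amin \<le> \<alpha> i" "\<And>i. \<alpha> i \<le> amax"
    and "0 < amin" "0 < \<sigma>"
    and min: "is_arg_min (prox_model G g \<alpha> y) (\<lambda>_. True) (y + d)"
  shows "y + d \<in> D" "\<And>i. G i y \<bullet> d + h i (y + d) - h i y \<le> - amin * (norm d)\<^sup>2"
    and "\<And>t. armijo \<sigma> f G g y d t \<Longrightarrow> 0 < t \<Longrightarrow> t \<le> 1 \<Longrightarrow> y + t *\<^sub>R d \<in> D"
    and "\<And>t i. armijo \<sigma> f G g y d t \<Longrightarrow> 0 < t \<Longrightarrow> t \<le> 1 \<Longrightarrow> \<Phi> i (y + t *\<^sub>R d) \<le> \<Phi> i y"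
    and "\<And>t z r i. armijo \<sigma> f G g y d t \<Longrightarrow> 0 < t \<Longrightarrow> t \<le> 1 \<Longrightarrow> 0 \<le> r \<Longrightarrow> z \<in> D \<Longrightarrow>
      (\<And>i. \<Phi> i z + r \<le> \<Phi> i y) \<Longrightarrow>
      t * (r / amax) \<le> (norm (z - y))\<^sup>2 / 2 - (norm (z - (y + t *\<^sub>R d)))\<^sup>2 / 2
        + (\<Phi> i y - \<Phi> i (y + t *\<^sub>R d)) / (\<sigma> * amin)"
proof -
  have \<alpha>_pos: "0 < \<alpha> i" for i
    using \<alpha>(1)[of i] \<open>0 < amin\<close> by simp
  define l where "l = (\<lambda>i. G i y \<bullet> d + h i (y + d) - h i y)"
  obtain b where dom: "y + d \<in> D" and b: "\<And>i. l i / \<alpha> i \<le> b"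
    and opt: "\<And>z a. z \<in> D \<Longrightarrow> (\<And>i. (G i y \<bullet> (z - y) + h i z - h i y) / \<alpha> i \<le> a) \<Longrightarrow>
      b + (norm d)\<^sup>2 / 2 + (norm (z - (y + d)))\<^sup>2 / 2 \<le> a + (norm (z - y))\<^sup>2 / 2"
    using prox_minimizer[OF \<open>y \<in> D\<close> \<alpha>_pos min] unfolding l_def by (metis add_diff_cancel_left')
  show "y + d \<in> D"
    by (rule dom)
  \<comment> \<open>Comparing with \<open>y\<close> itself gives two halves of
    \<open>(norm d)\<^sup>2\<close>: one from the proximal term, one from strong convexity.\<close>
  have "b \<le> - (norm d)\<^sup>2"
    using opt[of y 0] \<open>y \<in> D\<close> by simp
  have desc: "l i \<le> - amin * (norm d)\<^sup>2" for i
  proof -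
    have "l i \<le> \<alpha> i * b"
      using b[of i] \<alpha>_pos[of i] by (simp add: field_simps)
    also have "\<dots> \<le> \<alpha> i * (- (norm d)\<^sup>2)"
      using \<alpha>_pos[of i] \<open>b \<le> - (norm d)\<^sup>2\<close> by (intro mult_left_mono) auto
    also have "\<dots> \<le> - amin * (norm d)\<^sup>2"
      using \<alpha>(1)[of i] by (simp add: mult_right_mono)
    finally show ?thesis .
  qed
  then show "G i y \<bullet> d + h i (y + d) - h i y \<le> - amin * (norm d)\<^sup>2" for i
    by (simp add: l_def)
  fix t
  assume arm: "armijo \<sigma> f G g y d t" and t: "0 < t" "t \<le> 1"
  have y': "y + t *\<^sub>R d = (1 - t) *\<^sub>R y + t *\<^sub>R (y + d)"
    by (simp add: algebra_simps)
  show dom': "y + t *\<^sub>R d \<in> D"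
    unfolding y' using \<open>y \<in> D\<close> dom t by (intro convex_comb_dom(1)) auto
  have dec: "\<Phi> i (y + t *\<^sub>R d) - \<Phi> i y \<le> t * \<sigma> * l i" for i
    using arm \<open>y \<in> D\<close> dom dom'
    by (simp add: armijo_def composite_eq_Phi lin_model_def g_eq l_def)
  have l_le: "l i \<le> 0" for i
    using desc[of i] \<open>0 < amin\<close> by (smt (verit) mult_nonneg_nonneg mult_minus_left zero_le_power2)
  show "\<Phi> i (y + t *\<^sub>R d) \<le> \<Phi> i y" for i
    using dec[of i] mult_nonneg_nonpos[OF _ l_le[of i], of "t * \<sigma>"] t \<open>0 < \<sigma>\<close> by simp
  fix z r i
  assume r: "0 \<le> r" and "z \<in> D" and le: "\<And>i. \<Phi> i z + r \<le> \<Phi> i y"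
  \<comment> \<open>Convexity of \<open>f j\<close> turns the gap in the objective into a gap in the
    linear model; \<open>\<alpha> j \<le> amax\<close> makes the bound uniform in
    \<open>j\<close>.\<close>
  have "(G j y \<bullet> (z - y) + h j z - h j y) / \<alpha> j \<le> - (r / amax)" for j
  proof -
    have "G j y \<bullet> (z - y) \<le> f j z - f j y"
      by (intro convex_on_gradient_ineq f_convex grad)
    with le[of j] have "(G j y \<bullet> (z - y) + h j z - h j y) / \<alpha> j \<le> (- r) / \<alpha> j"
      using \<alpha>_pos[of j] by (intro divide_right_mono) (auto simp: \<Phi>_def)
    moreover have "r / amax \<le> r / \<alpha> j"
      using \<alpha>(2)[of j] \<alpha>_pos[of j] r by (intro divide_left_mono) auto
    ultimately show ?thesis
      by simp
  qed
  from opt[OF \<open>z \<in> D\<close> this]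
  have "b + (norm d)\<^sup>2 / 2 + (norm (z - (y + d)))\<^sup>2 / 2 \<le> - (r / amax) + (norm (z - y))\<^sup>2 / 2" .
  then have "r / amax \<le> (norm (z - y))\<^sup>2 / 2 - (norm (z - (y + d)))\<^sup>2 / 2 - b"
    using zero_le_power2[of "norm d"] by linarith
  then have "t * (r / amax) \<le> t * ((norm (z - y))\<^sup>2 / 2 - (norm (z - (y + d)))\<^sup>2 / 2 - b)"
    using t by (intro mult_left_mono) auto
  moreover have "(norm (z - (y + t *\<^sub>R d)))\<^sup>2 \<le>
      (1 - t) * (norm (z - y))\<^sup>2 + t * (norm (z - (y + d)))\<^sup>2"
  proof -
    have "z - (y + t *\<^sub>R d) = (1 - t) *\<^sub>R (z - y) + t *\<^sub>R (z - (y + d))"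
      by (simp add: algebra_simps)
    then show ?thesis
      using t by (simp only: norm_convex_comb_sq) simp
  qed
  \<comment> \<open>As \<open>b\<close> dominates every \<open>l i / \<alpha> i\<close>, any single
    objective controls \<open>- b\<close>. The sign of \<open>l i\<close> allows \<open>amin\<close>
    in place of \<open>\<alpha> i\<close>, and Armijo bounds \<open>t * \<sigma> * (- l i)\<close>
    by the actual decrease.\<close>
  moreover have "t * (- b) \<le> (\<Phi> i y - \<Phi> i (y + t *\<^sub>R d)) / (\<sigma> * amin)"
  proof -
    have "- b \<le> (- l i) / \<alpha> i"
      using b[of i] by simp
    also have "\<dots> \<le> (- l i) / amin"
      using \<alpha>(1)[of i] \<open>0 < amin\<close> l_le[of i] \<alpha>_pos[of i] by (intro divide_left_mono) auto
    finally have "t * (- b) \<le> t * ((- l i) / amin)"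
      using t by (intro mult_left_mono) auto
    also have "\<dots> = (t * \<sigma> * (- l i)) / (\<sigma> * amin)"
      using \<open>0 < \<sigma>\<close> by simp
    also have "\<dots> \<le> (\<Phi> i y - \<Phi> i (y + t *\<^sub>R d)) / (\<sigma> * amin)"
      using dec[of i] \<open>0 < \<sigma>\<close> \<open>0 < amin\<close> by (intro divide_right_mono) auto
    finally show ?thesis .
  qed
  ultimately show "t * (r / amax) \<le> (norm (z - y))\<^sup>2 / 2 - (norm (z - (y + t *\<^sub>R d)))\<^sup>2 / 2
      + (\<Phi> i y - \<Phi> i (y + t *\<^sub>R d)) / (\<sigma> * amin)"
    unfolding right_diff_distrib left_diff_distrib times_divide_eq_right mult_minus_right by linarith
qed

section \<open>Uniform progress along the run\<close>

text \<open>The step sizes have a lower bound independent of \<open>k\<close>, because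
  \<open>armijo_small_step\<close> accepts all steps below a threshold built from
  \<open>\<sigma>\<close>, \<open>amin\<close> and the \<open>L i\<close>. This makes
  \<open>\<tau>\<close> a constant, so the one-step inequality can be summed.\<close>

lemma bbpgmo_run_progress:
  assumes run: "bbpgmo_run \<sigma> \<gamma> amin amax f G g xm1 x" and "x 0 \<in> D"
    and sigma: "0 < \<sigma>" "\<sigma> < 1" and gamma: "0 < \<gamma>" "\<gamma> < 1"
    and alpha: "0 < amin" "amin < amax"
  obtains \<tau> where "0 < \<tau>" "\<And>k. x k \<in> D" "\<And>i. decseq (\<lambda>k. \<Phi> i (x k))"
    "\<And>k z r i. 0 \<le> r \<Longrightarrow> z \<in> D \<Longrightarrow> (\<And>i. \<Phi> i z + r \<le> \<Phi> i (x k)) \<Longrightarrow>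
      \<tau> * r \<le> (norm (z - x k))\<^sup>2 / 2 - (norm (z - x (Suc k)))\<^sup>2 / 2
        + (\<Phi> i (x k) - \<Phi> i (x (Suc k))) / (\<sigma> * amin)"
proof -
  from run obtain \<alpha> d t where
    Suc: "\<And>k. x (Suc k) = x k + t k *\<^sub>R d k"
    and min: "\<And>k. is_arg_min (prox_model G g (\<alpha> k) (x k)) (\<lambda>_. True) (x k + d k)"
    and t: "\<And>k. is_arg_max id (\<lambda>s. s \<in> range (\<lambda>j. \<gamma> ^ j) \<and> armijo \<sigma> f G g (x k) (d k) s) (t k)"
    and \<alpha>: "\<And>k i. \<alpha> k i = bb_param amin amax (x k - (case k of 0 \<Rightarrow> xm1 | Suc j \<Rightarrow> x j))
      (G i (x k) - G i (case k of 0 \<Rightarrow> xm1 | Suc j \<Rightarrow> x j))"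
    unfolding bbpgmo_run_def Let_def by - (elim conjE exE, rule that, blast+)
  have \<alpha>': "amin \<le> \<alpha> k i" "\<alpha> k i \<le> amax" for k i
    unfolding \<alpha> using bb_param_bounds[of amin amax] alpha by auto
  have arm: "armijo \<sigma> f G g (x k) (d k) (t k)" for k
    using t[of k] by (simp add: is_arg_max_def)
  have t_range: "0 < t k" "t k \<le> 1" for k
    using t[of k] gamma by (auto simp: is_arg_max_def power_le_one)
  have dom: "x k \<in> D" for k
  proof (induction k)
    case (Suc k)
    show ?case
      unfolding \<open>x (Suc k) = _\<close>
      by (rule bbpgmo_step(3)[OF Suc.IH \<alpha>' alpha(1) sigma(1) min arm t_range])
  qed fact
  \<comment> \<open>A common upper bound for the \<open>L i\<close>; the absolute values and the 1
    make it positive without a sign condition on \<open>L i\<close>.\<close>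
  define M where "M = (\<Sum>i\<in>UNIV. \<bar>L i\<bar>) + 1"
  have "0 < M"
    unfolding M_def by (simp add: sum_nonneg add_nonneg_pos)
  have L_le: "L i \<le> M" for i
  proof -
    have "\<bar>L i\<bar> \<le> (\<Sum>i\<in>UNIV. \<bar>L i\<bar>)"
      by (rule member_le_sum) auto
    then show ?thesis
      by (simp add: M_def)
  qed
  have "0 < (1 - \<sigma>) * amin / M"
    using sigma alpha \<open>0 < M\<close> by simp
  then obtain J where J: "\<gamma> ^ J < (1 - \<sigma>) * amin / M"
    using real_arch_pow_inv[of _ \<gamma>] gamma by blast
  have t_ge: "\<gamma> ^ J \<le> t k" for k
  proof -
    have "armijo \<sigma> f G g (x k) (d k) (\<gamma> ^ J)"
    proof (rule armijo_small_step[where a = amin])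
      show "\<gamma> ^ J * L i \<le> (1 - \<sigma>) * amin" for i
      proof -
        have "\<gamma> ^ J * L i \<le> \<gamma> ^ J * M"
          using gamma by (intro mult_left_mono L_le) auto
        also have "\<dots> \<le> (1 - \<sigma>) * amin"
          using J \<open>0 < M\<close> by (simp add: field_simps)
        finally show ?thesis .
      qed
      show "x k + d k \<in> D"
        by (rule bbpgmo_step(1)[OF dom \<alpha>' alpha(1) sigma(1) min])
      show "G i (x k) \<bullet> d k + h i (x k + d k) - h i (x k) \<le> - amin * (norm (d k))\<^sup>2" for i
        by (rule bbpgmo_step(2)[OF dom \<alpha>' alpha(1) sigma(1) min])
    qed (use dom gamma sigma in \<open>auto simp: power_le_one\<close>)
    \<comment> \<open>\<open>t k\<close> is the largest accepted power of \<open>\<gamma>\<close>,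
      hence at least the accepted \<open>\<gamma> ^ J\<close>.\<close>
    then show ?thesis
      using t[of k] by (auto simp: is_arg_max_def not_less)
  qed
  show thesis
  proof (rule that[of "\<gamma> ^ J / amax"])
    show "0 < \<gamma> ^ J / amax"
      using gamma alpha by simp
    show "x k \<in> D" for k
      by (rule dom)
    show "decseq (\<lambda>k. \<Phi> i (x k))" for i
      unfolding decseq_Suc_iff Suc
      using bbpgmo_step(4)[OF dom \<alpha>' alpha(1) sigma(1) min arm t_range] by blast
    show "\<gamma> ^ J / amax * r \<le> (norm (z - x k))\<^sup>2 / 2 - (norm (z - x (Suc k)))\<^sup>2 / 2
        + (\<Phi> i (x k) - \<Phi> i (x (Suc k))) / (\<sigma> * amin)"
      if "0 \<le> r" "z \<in> D" "\<And>i. \<Phi> i z + r \<le> \<Phi> i (x k)" for k z r i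
    proof -
      have "\<gamma> ^ J / amax * r \<le> t k * (r / amax)"
        using t_ge[of k] that(1) alpha by (simp add: divide_right_mono mult_right_mono)
      also have "\<dots> \<le> (norm (z - x k))\<^sup>2 / 2 - (norm (z - x (Suc k)))\<^sup>2 / 2
          + (\<Phi> i (x k) - \<Phi> i (x (Suc k))) / (\<sigma> * amin)"
        unfolding Suc
        by (rule bbpgmo_step(5)[OF dom \<alpha>' alpha(1) sigma(1) min arm t_range that])
      finally show ?thesis .
    qed
  qed
qed

section \<open>From gaps to the merit function\<close>

text \<open>If \<open>z\<close> fails to improve some objective, the minimum is at most 0. Otherwise
  \<open>z\<close> lies in \<open>D\<close>, and the smallest improvement is an admissible
  \<open>r\<close>.\<close>

lemma merit_u0_le:
  assumes "0 < a" "0 \<le> c" "y \<in> D"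
    and le: "\<And>z r. z \<in> D \<Longrightarrow> 0 \<le> r \<Longrightarrow> (\<And>i. \<Phi> i z + r \<le> \<Phi> i y) \<Longrightarrow> r \<le> a * c"
  shows "merit_u0 a (composite f g) y \<le> ereal c"
  unfolding merit_u0_def
proof (rule SUP_least)
  fix z
  let ?q = "\<lambda>i. (composite f g i y - composite f g i z) / ereal a"
  show "(MIN i. ?q i) \<le> ereal c"
  proof (cases "\<exists>i. composite f g i y \<le> composite f g i z")
    case True
    then obtain i where i: "composite f g i y \<le> composite f g i z" ..
    then have "?q i \<le> 0"
      using \<open>y \<in> D\<close> \<open>0 < a\<close>
      by (cases "composite f g i z") (auto simp: composite_eq_Phi divide_nonpos_pos)
    moreover have "(MIN i. ?q i) \<le> ?q i"
      by (intro Min_le) auto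
    ultimately show ?thesis
      using \<open>0 \<le> c\<close> by (meson ereal_less_eq(5) order_trans)
  next
    case False
    then have lt: "composite f g i z < composite f g i y" for i
      by (simp add: not_le)
    then have "z \<in> D"
      using \<open>y \<in> D\<close> by (metis D_iff less_trans)
    define r where "r = (MIN i. \<Phi> i y - \<Phi> i z)"
    have "r \<in> range (\<lambda>i. \<Phi> i y - \<Phi> i z)"
      unfolding r_def by (intro Min_in) auto
    then obtain i0 where i0: "r = \<Phi> i0 y - \<Phi> i0 z" by blast
    have r: "r \<le> \<Phi> i y - \<Phi> i z" for i
      unfolding r_def by (intro Min_le) auto
    have "r \<le> a * c"
    proof (rule le[OF \<open>z \<in> D\<close>])
      show "0 \<le> r"
        using lt[of i0] \<open>y \<in> D\<close> \<open>z \<in> D\<close> by (simp add: i0 composite_eq_Phi)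
      show "\<Phi> i z + r \<le> \<Phi> i y" for i
        using r[of i] by simp
    qed
    have "(MIN i. ?q i) \<le> ?q i0"
      by (intro Min_le) auto
    also have "\<dots> = ereal (r / a)"
      using \<open>y \<in> D\<close> \<open>z \<in> D\<close> \<open>0 < a\<close> by (simp add: composite_eq_Phi i0)
    also have "\<dots> \<le> ereal c"
      using \<open>r \<le> a * c\<close> \<open>0 < a\<close> by (simp add: field_simps)
    finally show ?thesis .
  qed
qed

section \<open>Convergence of the iterates and the rate\<close>

theorem bbpgmo_convergence:
  assumes run: "bbpgmo_run \<sigma> \<gamma> amin amax f G g xm1 x" and "x 0 \<in> D"
    and sigma: "0 < \<sigma>" "\<sigma> < 1" and gamma: "0 < \<gamma>" "\<gamma> < 1"
    and alpha: "0 < amin" "amin < amax"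
    and bdd: "bounded {z. \<forall>i. composite f g i z \<le> composite f g i (x 0)}"
  shows "\<exists>xs. x \<longlonglongrightarrow> xs \<and> weakly_pareto (composite f g) xs"
    and "\<exists>c>0. \<forall>k\<ge>1. merit_u0 amin (composite f g) (x k) \<le> ereal (c / real k)"
proof -
  obtain \<tau> where "0 < \<tau>" and dom: "\<And>k. x k \<in> D" and dec: "\<And>i. decseq (\<lambda>k. \<Phi> i (x k))"
    and step: "\<And>k z r i. 0 \<le> r \<Longrightarrow> z \<in> D \<Longrightarrow> (\<And>i. \<Phi> i z + r \<le> \<Phi> i (x k)) \<Longrightarrow>
      \<tau> * r \<le> (norm (z - x k))\<^sup>2 / 2 - (norm (z - x (Suc k)))\<^sup>2 / 2
        + (\<Phi> i (x k) - \<Phi> i (x (Suc k))) / (\<sigma> * amin)"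
    using bbpgmo_run_progress[OF run \<open>x 0 \<in> D\<close> sigma gamma alpha] by metis
  have dec_le: "\<Phi> i (x k) \<le> \<Phi> i (x j)" if "j \<le> k" for i j k
    using dec that by (auto simp: decseq_def)
  let ?\<Omega> = "{z. \<forall>i. composite f g i z \<le> composite f g i (x 0)}"
  have \<Omega>_iff: "z \<in> ?\<Omega> \<longleftrightarrow> (\<forall>i. \<Phi> i z \<le> \<Phi> i (x 0))" if "z \<in> D" for z
    using that dom by (simp add: composite_eq_Phi)
  obtain B where B: "\<And>z. z \<in> ?\<Omega> \<Longrightarrow> norm (z - x 0) \<le> B"
    using bdd bounded_any_center[of ?\<Omega> "x 0"] by (auto simp: dist_norm norm_minus_commute)
  have "range x \<subseteq> ?\<Omega>"
    using \<Omega>_iff[OF dom] dec_le by blast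
  with bdd have "bounded (range x)"
    by (rule bounded_subset)
  then obtain xs \<rho> where "strict_mono \<rho>" and sub: "(x \<circ> \<rho>) \<longlonglongrightarrow> xs"
    using bounded_imp_convergent_subsequence by blast
  \<comment> \<open>By monotonicity the subsequence stays in the sublevel set of \<open>x k\<close>
    from index \<open>k\<close> on, since \<open>\<rho> n \<ge> n\<close>. The case
    \<open>k = 0\<close> then gives \<open>xs \<in> D\<close>.\<close>
  have xs_le: "composite f g i xs \<le> ereal (\<Phi> i (x k))" for i k
  proof (rule composite_lsc_le[OF sub])
    have "\<Phi> i ((x \<circ> \<rho>) n) \<le> \<Phi> i (x k)" if "k \<le> n" for n
      using dec_le[of k "\<rho> n" i] seq_suble[OF \<open>strict_mono \<rho>\<close>, of n] that by simp
    then show "eventually (\<lambda>n. composite f g i ((x \<circ> \<rho>) n) \<le> ereal (\<Phi> i (x k))) sequentially"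
      using dom by (auto simp: composite_eq_Phi eventually_sequentially)
  qed
  have "xs \<in> D"
    unfolding D_iff using le_less_trans[OF xs_le[of _ 0], where z = \<infinity>] by auto
  with xs_le have Phi_xs: "\<Phi> i xs \<le> \<Phi> i (x k)" for i k
    by (simp add: composite_eq_Phi)

  have "x \<longlonglongrightarrow> xs"
  proof -
    fix i :: 'm
    define C where "C = 1 / (\<sigma> * amin)"
    have "0 < C"
      using sigma alpha by (simp add: C_def)
    define A where "A = (\<lambda>k. (norm (xs - x k))\<^sup>2 / 2 + C * (\<Phi> i (x k)))"
    obtain l where l: "(\<lambda>k. \<Phi> i (x k)) \<longlonglongrightarrow> l"
      using decseq_convergent[OF dec] Phi_xs by metis
    have "A (Suc k) \<le> A k" for k
      using step[of 0 xs k i] \<open>xs \<in> D\<close> Phi_xs by (simp add: A_def C_def diff_divide_distrib)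
    then have "decseq A"
      by (simp add: decseq_Suc_iff)
    moreover have "C * \<Phi> i xs \<le> A k" for k
      using Phi_xs[of i k] \<open>0 < C\<close> by (simp add: A_def add_increasing)
    ultimately obtain a where a: "A \<longlonglongrightarrow> a"
      using decseq_convergent by metis
    \<comment> \<open>\<open>A\<close> and the objective values both converge, so the squared
      distances converge along the whole sequence; the subsequence identifies their limit as
      0.\<close>
    have lim: "(\<lambda>k. 2 * (A k - C * \<Phi> i (x k))) \<longlonglongrightarrow> 2 * (a - C * l)"
      by (intro tendsto_intros a l)
    then have sq: "(\<lambda>k. (norm (xs - x k))\<^sup>2) \<longlonglongrightarrow> 2 * (a - C * l)"
      by (simp add: A_def)
    have "(\<lambda>n. (norm (xs - (x \<circ> \<rho>) n))\<^sup>2) \<longlonglongrightarrow> 2 * (a - C * l)"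
      using LIMSEQ_subseq_LIMSEQ[OF sq \<open>strict_mono \<rho>\<close>] by (simp add: o_def)
    moreover have "(\<lambda>n. (norm (xs - (x \<circ> \<rho>) n))\<^sup>2) \<longlonglongrightarrow> (norm (xs - xs))\<^sup>2"
      by (intro tendsto_intros sub)
    ultimately have "2 * (a - C * l) = (norm (xs - xs))\<^sup>2"
      by (rule LIMSEQ_unique)
    with sq have "(\<lambda>k. (norm (xs - x k))\<^sup>2) \<longlonglongrightarrow> 0"
      by simp
    then have "(\<lambda>k. sqrt ((norm (xs - x k))\<^sup>2)) \<longlonglongrightarrow> sqrt 0"
      by (rule tendsto_real_sqrt)
    then show ?thesis
      by (simp add: LIMSEQ_iff norm_minus_commute)
  qed

  obtain K where "0 \<le> K" and rate: "\<And>k z r. z \<in> D \<Longrightarrow> 0 \<le> r \<Longrightarrow>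
      (\<And>i. \<Phi> i z + r \<le> \<Phi> i (x k)) \<Longrightarrow> real k * (\<tau> * r) \<le> K"
  proof -
    fix i :: 'm
    \<comment> \<open>\<open>B\<close> bounds the initial distance, as every competitor
      \<open>z\<close> lies in the level set; the second term bounds the total decrease of objective
      \<open>i\<close>. Neither depends on \<open>z\<close>, \<open>r\<close> or
      \<open>k\<close>.\<close>
    define K where "K = B\<^sup>2 / 2 + (\<Phi> i (x 0) - \<Phi> i xs) / (\<sigma> * amin)"
    have K: "real k * (\<tau> * r) \<le> K"
      if "z \<in> D" "0 \<le> r" and le: "\<And>i. \<Phi> i z + r \<le> \<Phi> i (x k)" for k z r
    proof -
      \<comment> \<open>A gap at \<open>x k\<close> persists at all earlier iterates, whose
        objective values are no smaller; hence \<open>step\<close> applies to each summand.\<close>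
      have le': "\<Phi> i z + r \<le> \<Phi> i (x j)" if "j \<le> k" for i j
        using le[of i] dec_le[OF that, of i] by linarith
      have "real k * (\<tau> * r) = (\<Sum>j<k. \<tau> * r)"
        by simp
      also have "\<dots> \<le> (\<Sum>j<k. ((norm (z - x j))\<^sup>2 / 2 + \<Phi> i (x j) / (\<sigma> * amin))
          - ((norm (z - x (Suc j)))\<^sup>2 / 2 + \<Phi> i (x (Suc j)) / (\<sigma> * amin)))"
      proof (rule sum_mono)
        fix j
        assume "j \<in> {..<k}"
        then show "\<tau> * r \<le> ((norm (z - x j))\<^sup>2 / 2 + \<Phi> i (x j) / (\<sigma> * amin))
          - ((norm (z - x (Suc j)))\<^sup>2 / 2 + \<Phi> i (x (Suc j)) / (\<sigma> * amin))"
          using step[OF \<open>0 \<le> r\<close> \<open>z \<in> D\<close> le', of j i] by (simp add: diff_divide_distrib)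
      qed
      also have "\<dots> = ((norm (z - x 0))\<^sup>2 / 2 + \<Phi> i (x 0) / (\<sigma> * amin))
          - ((norm (z - x k))\<^sup>2 / 2 + \<Phi> i (x k) / (\<sigma> * amin))"
        by (rule sum_lessThan_telescope')
      also have "\<dots> \<le> (norm (z - x 0))\<^sup>2 / 2 + (\<Phi> i (x 0) - \<Phi> i (x k)) / (\<sigma> * amin)"
        by (simp add: diff_divide_distrib)
      also have "\<dots> \<le> K"
      proof -
        have "z \<in> ?\<Omega>"
          unfolding \<Omega>_iff[OF \<open>z \<in> D\<close>] using le'[of 0] \<open>0 \<le> r\<close> by (smt (verit) le0)
        then have "(norm (z - x 0))\<^sup>2 \<le> B\<^sup>2"
          by (intro power_mono B) auto
        moreover have "(\<Phi> i (x 0) - \<Phi> i (x k)) / (\<sigma> * amin) \<le> (\<Phi> i (x 0) - \<Phi> i xs) / (\<sigma> * amin)"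
          using Phi_xs[of i k] sigma alpha by (intro divide_right_mono) auto
        ultimately show ?thesis
          by (simp add: K_def)
      qed
      finally show ?thesis .
    qed
    moreover have "0 \<le> K"
      using K[of xs 0 0] \<open>xs \<in> D\<close> Phi_xs by simp
    ultimately show thesis
      using that by blast
  qed

  have "\<not> (\<exists>z. \<forall>i. composite f g i z < composite f g i xs)"
  proof
    assume "\<exists>z. \<forall>i. composite f g i z < composite f g i xs"
    then obtain z where z: "\<And>i. composite f g i z < composite f g i xs" by blast
    then have "z \<in> D"
      using \<open>xs \<in> D\<close> by (metis D_iff less_trans)
    \<comment> \<open>The smallest improvement over \<open>xs\<close> is positive because there are
      finitely many objectives. It is also a gap at every \<open>x k\<close>, so the rate bound
      would hold for all \<open>k\<close> with this fixed \<open>r\<close>.\<close>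
    define r where "r = (MIN i. \<Phi> i xs - \<Phi> i z)"
    have "0 < r"
      unfolding r_def using z \<open>z \<in> D\<close> \<open>xs \<in> D\<close> by (subst Min_gr_iff) (auto simp: composite_eq_Phi)
    have "r \<le> \<Phi> i xs - \<Phi> i z" for i
      unfolding r_def by (intro Min_le) auto
    with Phi_xs have "\<Phi> i z + r \<le> \<Phi> i (x k)" for i k
      by (smt (verit))
    from rate[OF \<open>z \<in> D\<close> less_imp_le[OF \<open>0 < r\<close>] this]
    have "real k * (\<tau> * r) \<le> K" for k .
    moreover obtain k where "K < real k * (\<tau> * r)"
      using reals_Archimedean3[of "\<tau> * r"] \<open>0 < \<tau>\<close> \<open>0 < r\<close> by auto
    ultimately show False
      by (simp add: leD)
  qed
  with \<open>xs \<in> D\<close> \<open>x \<longlonglongrightarrow> xs\<close> show "\<exists>xs. x \<longlonglongrightarrow> xs \<and> weakly_pareto (composite f g) xs"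
    by (auto simp: weakly_pareto_def in_dom_iff)

  \<comment> \<open>The factor \<open>amin\<close> comes from the scaling of the merit function;
    adding 1 keeps \<open>c\<close> positive when \<open>K = 0\<close>.\<close>
  define c where "c = K / (\<tau> * amin) + 1"
  have "0 < c"
    using \<open>0 \<le> K\<close> \<open>0 < \<tau>\<close> alpha by (simp add: c_def add_nonneg_pos)
  moreover have "merit_u0 amin (composite f g) (x k) \<le> ereal (c / real k)" if "1 \<le> k" for k
  proof (rule merit_u0_le[OF alpha(1) _ dom])
    fix z r
    assume "z \<in> D" "0 \<le> r" "\<And>i. \<Phi> i z + r \<le> \<Phi> i (x k)"
    then have "real k * (\<tau> * r) \<le> K"
      by (rule rate)
    also have "\<dots> \<le> c * (\<tau> * amin)"
      using \<open>0 < \<tau>\<close> alpha by (simp add: c_def field_simps)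
    finally have "\<tau> * (real k * r) \<le> \<tau> * (c * amin)"
      by (simp add: mult_ac)
    then have "real k * r \<le> c * amin"
      using \<open>0 < \<tau>\<close> by simp
    then show "r \<le> amin * (c / real k)"
      using that by (simp add: field_simps)
  qed (use \<open>0 < c\<close> in simp)
  ultimately show "\<exists>c>0. \<forall>k\<ge>1. merit_u0 amin (composite f g) (x k) \<le> ereal (c / real k)"
    by blast
qed

end

section \<open>Specialization to \<open>real ^ 'n\<close>\<close>

theorem theorem4p2:
  fixes f :: "'m::finite \<Rightarrow> real ^ 'n \<Rightarrow> real"
    and G :: "'m \<Rightarrow> real ^ 'n \<Rightarrow> real ^ 'n"
    and g :: "'m \<Rightarrow> real ^ 'n \<Rightarrow> ereal"
    and F :: "'m \<Rightarrow> real ^ 'n \<Rightarrow> ereal"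
    and L :: "'m \<Rightarrow> real"
    and \<sigma> \<gamma> amin amax :: real
    and xm1 :: "real ^ 'n"
    and x :: "nat \<Rightarrow> real ^ 'n"
  defines "F \<equiv> composite f g"
  assumes grad: "\<And>i z. GDERIV (f i) z :> G i z"
    and C1: "\<And>i. continuous_on UNIV (G i)"
    and g_proper: "\<And>i. proper (g i)"
    and g_convex: "\<And>i. convex_ereal (g i)"
    and g_lsc: "\<And>i. lsc (g i)"
    and f_convex: "\<And>i. convex_on UNIV (f i)"
    and f_smooth: "\<And>i. L_smooth (L i) (G i)"
    and sigma: "0 < \<sigma>" "\<sigma> < 1"
    and gamma: "0 < \<gamma>" "\<gamma> < 1"
    and alpha: "0 < amin" "amin < amax"
    and x0_dom: "in_dom F (x 0)"
    and level_bounded: "bounded {z. \<forall>i. F i z \<le> F i (x 0)}"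
    and run: "bbpgmo_run \<sigma> \<gamma> amin amax f G g xm1 x"
    and not_critical: "\<And>k. \<not> pareto_critical F (x k)"
  shows "(\<exists>xs. x \<longlonglongrightarrow> xs \<and> weakly_pareto F xs) \<and>
         (\<exists>c::real. c > 0 \<and> (\<forall>k::nat. k \<ge> 1 \<longrightarrow> merit_u0 amin F (x k) \<le> ereal (c / real k)))"
proof -
  interpret composite_problem f G g L
    by (rule composite_problem.intro) fact+
  have "x 0 \<in> D"
    using x0_dom by (simp add: F_def in_dom_iff)
  note * = bbpgmo_convergence[OF run this sigma gamma alpha level_bounded[unfolded F_def]]
  show ?thesis
    unfolding F_def using * by blast
qed

end
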